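(* Let $\tau$ be an arbitrary two-qubit state on $AB$, written as $$\tau=\tfrac14\Big(I\otimes I+\sum_{i=1}^3 a_i\,\sigma_i\otimes I+\sum_{j=1}^3 b_j\, I\otimes\sigma_j+\sum_{i,j=1}^3 t_{ij}\,\sigma_i\otimes\sigma_j\Big),$$ and let $\Pi=\{p_{l|k}\}_{k,l\in\{0,1,2,3\}}$ be a classical channel, i.e. $p_{l|k}\ge 0$ and $\sum_{l=0}^3 p_{l|k}=1$ for every $k$. Then noisy teleportation over $\tau$ with classical channel $\Pi$ simulates the qubit channel $\mathcal{E}_f$ whose action on Bloch vectors is $$(x,y,z)\mapsto\big(f_{10}+f_{11}x+f_{12}y+f_{13}z,\; f_{20}+f_{21}x+f_{22}y+f_{23}z,\; f_{30}+f_{31}x+f_{32}y+f_{33}z\big),$$ where for $i\in\{1,2,3\}$ and $j\in\{0,1,2,3\}$ one has $f_{ij}=t'_{ji}\,S_{ij}$, with $$S_{ij}=\frac14\sum_{k,l=0}^{3}(-1)^{\delta_{k,0}+\delta_{j,2}+\delta_{j,0}+\delta_{k,j}+\delta_{i,l}+\delta_{0,l}}\;p_{l|k}$$ and $$t'_{ji}=\begin{cases} b_i & \text{if } j=0,\\ t_{ji} & \text{if } j\in\{1,2,3\}.\end{cases}$$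
   Context: $(\sigma_0,\sigma_1,\sigma_2,\sigma_3)=(I,\sigma_x,\sigma_y,\sigma_z)$ are the Pauli matrices and $\delta$ is the Kronecker delta. The Bloch vector $(x,y,z)$ of a qubit state $\rho$ is defined by $\rho=\frac12(I+x\sigma_x+y\sigma_y+z\sigma_z)$. Bell projectors: $E_0=|\Phi^+\rangle\langle\Phi^+|$, $E_1=|\Psi^+\rangle\langle\Psi^+|$, $E_2=|\Psi^-\rangle\langle\Psi^-|$, $E_3=|\Phi^-\rangle\langle\Phi^-|$, where $|\Phi^\pm\rangle=\frac1{\sqrt2}(|00\rangle\pm|11\rangle)$ and $|\Psi^\pm\rangle=\frac1{\sqrt2}(|01\rangle\pm|10\rangle)$. Noisy teleportation over $\tau=\tau_{AB}$ with classical channel $\Pi$: Alice holds the input qubit $C$ in state $\rho$ and qubit $A$ of $\tau_{AB}$, Bob holds qubit $B$. Alice performs the Bell measurement $\{E_k\}_{k=0}^3$ on $CA$; when the outcome is $k$, Bob applies the Pauli unitary $\sigma_l$ to $B$ with probability $p_{l|k}$. The simulated qubit channel is $$\rho\mapsto\sum_{k,l=0}^3 p_{l|k}\;\sigma_l\,\mathrm{Tr}_{CA}\big[(E_k)_{CA}(\rho_C\otimes\tau_{AB})\big]\,\sigma_l .$$ *)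

theory Defs
  imports "HOL-Analysis.Analysis"
begin

text \<open>
  The basis vectors |0> and |1> of a qubit are indexed by the two elements 0 and 1 of the type 2,
  and tensor products are indexed by product types. The library function
  \<open>vector\<close> enumerates this type as 1, 2 with 2 = 0, which is the wrong order for
  writing down matrices in the basis |0>, |1>; hence \<open>mat2\<close>.
\<close>

type_synonym 'n cmat = "complex^'n^'n"

definition mat2 :: "complex \<Rightarrow> complex \<Rightarrow> complex \<Rightarrow> complex \<Rightarrow> 2 cmat" where
  "mat2 a b c d =
     (\<chi> i j. if i = 0 then (if j = 0 then a else b) else (if j = 0 then c else d))"

definition pauli :: "nat \<Rightarrow> 2 cmat" where
  "pauli k = [mat2 1 0 0 1, mat2 0 1 1 0, mat2 0 (- \<i>) \<i> 0, mat2 1 0 0 (- 1)] ! k"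

definition kron :: "('m::finite) cmat \<Rightarrow> ('n::finite) cmat \<Rightarrow> ('m \<times> 'n) cmat" (infixr "\<otimes>" 75) where
  "A \<otimes> B = (\<chi> i j. A $ fst i $ fst j * B $ snd i $ snd j)"

definition cscale :: "complex \<Rightarrow> ('n::finite) cmat \<Rightarrow> 'n cmat" where
  "cscale c A = (\<chi> i j. c * A $ i $ j)"

definition cdot :: "complex^'n \<Rightarrow> complex^'n \<Rightarrow> complex" where
  "cdot v w = (\<Sum>i\<in>UNIV. cnj (v $ i) * w $ i)"

text \<open>Hermitian symmetry follows from this condition over the complex numbers.\<close>

definition pos_semidef :: "('n::finite) cmat \<Rightarrow> bool" where
  "pos_semidef A \<longleftrightarrow> (\<forall>v. cdot v (A *v v) \<in> \<real>\<^sub>\<ge>\<^sub>0)"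

definition density_operator :: "('n::finite) cmat \<Rightarrow> bool" where
  "density_operator \<rho> \<longleftrightarrow> pos_semidef \<rho> \<and> trace \<rho> = 1"

text \<open>
  An operator on the tensor product of \<open>\<complex>\<^sup>n\<close> with the system is represented by its
  \<open>n \<times> n\<close> array of blocks; applying the map to every block is the action of the identity
  tensored with the map. This allows \<open>n\<close> to be quantified inside the definition.
\<close>

definition block_pos_semidef :: "nat \<Rightarrow> (nat \<Rightarrow> nat \<Rightarrow> ('n::finite) cmat) \<Rightarrow> bool" where
  "block_pos_semidef n X \<longleftrightarrow>
     (\<forall>v. (\<Sum>r<n. \<Sum>s<n. cdot (v r) (X r s *v v s)) \<in> \<real>\<^sub>\<ge>\<^sub>0)"

definition completely_positive :: "(('m::finite) cmat \<Rightarrow> ('n::finite) cmat) \<Rightarrow> bool" where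
  "completely_positive \<Phi> \<longleftrightarrow>
     (\<forall>n X. block_pos_semidef n X \<longrightarrow> block_pos_semidef n (\<lambda>r s. \<Phi> (X r s)))"

definition quantum_channel :: "(('m::finite) cmat \<Rightarrow> ('n::finite) cmat) \<Rightarrow> bool" where
  "quantum_channel \<Phi> \<longleftrightarrow>
     (\<forall>A B. \<Phi> (A + B) = \<Phi> A + \<Phi> B) \<and>
     (\<forall>c A. \<Phi> (cscale c A) = cscale c (\<Phi> A)) \<and>
     completely_positive \<Phi> \<and>
     (\<forall>A. trace (\<Phi> A) = trace A)"

definition bloch_operator :: "real \<Rightarrow> real \<Rightarrow> real \<Rightarrow> 2 cmat" where
  "bloch_operator x y z =
     (1/2) *\<^sub>R (mat 1 + x *\<^sub>R pauli 1 + y *\<^sub>R pauli 2 + z *\<^sub>R pauli 3)"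

definition ket2 :: "2 \<Rightarrow> 2 \<Rightarrow> complex^(2 \<times> 2)" where
  "ket2 a b = axis (a, b) 1"

definition projector :: "complex^'n \<Rightarrow> ('n::finite) cmat" where
  "projector v = (\<chi> i j. v $ i * cnj (v $ j))"

definition bell_vector :: "nat \<Rightarrow> complex^(2 \<times> 2)" where
  "bell_vector k = (1 / sqrt 2) *\<^sub>R
     [ket2 0 0 + ket2 1 1, ket2 0 1 + ket2 1 0, ket2 0 1 - ket2 1 0, ket2 0 0 - ket2 1 1] ! k"

definition bell_projector :: "nat \<Rightarrow> (2 \<times> 2) cmat" where
  "bell_projector k = projector (bell_vector k)"

text \<open>The three-qubit system is indexed by triples (c, a, b) for the qubits C, A, B in this order.\<close>

definition on_CA :: "(2 \<times> 2) cmat \<Rightarrow> (2 \<times> 2 \<times> 2) cmat" where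
  "on_CA E = (\<chi> i j. case (i, j) of ((c, a, b), (c', a', b')) \<Rightarrow>
     (E \<otimes> mat 1) $ ((c, a), b) $ ((c', a'), b'))"

definition trace_CA :: "(2 \<times> 2 \<times> 2) cmat \<Rightarrow> 2 cmat" where
  "trace_CA M = (\<chi> b b'. \<Sum>c\<in>UNIV. \<Sum>a\<in>UNIV. M $ (c, a, b) $ (c, a, b'))"

text \<open>Here and below, \<open>p l k\<close> stands for the conditional probability of \<open>l\<close> given \<open>k\<close>.\<close>

definition classical_channel :: "(nat \<Rightarrow> nat \<Rightarrow> real) \<Rightarrow> bool" where
  "classical_channel p \<longleftrightarrow>
     (\<forall>k\<le>3. \<forall>l\<le>3. 0 \<le> p l k) \<and> (\<forall>k\<le>3. (\<Sum>l\<le>3. p l k) = 1)"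

definition noisy_teleportation ::
    "(2 \<times> 2) cmat \<Rightarrow> (nat \<Rightarrow> nat \<Rightarrow> real) \<Rightarrow> 2 cmat \<Rightarrow> 2 cmat" where
  "noisy_teleportation \<tau> p \<rho> =
     (\<Sum>k\<le>3. \<Sum>l\<le>3. p l k *\<^sub>R
        (pauli l ** trace_CA (on_CA (bell_projector k) ** (\<rho> \<otimes> \<tau>)) ** pauli l))"

definition kdelta :: "nat \<Rightarrow> nat \<Rightarrow> nat" where
  "kdelta m n = (if m = n then 1 else 0)"

definition S_coeff :: "(nat \<Rightarrow> nat \<Rightarrow> real) \<Rightarrow> nat \<Rightarrow> nat \<Rightarrow> real" where
  "S_coeff p i j = (1/4) * (\<Sum>k\<le>3. \<Sum>l\<le>3.
     (-1) ^ (kdelta k 0 + kdelta j 2 + kdelta j 0 + kdelta k j + kdelta i l + kdelta 0 l) * p l k)"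

definition t_ext :: "(nat \<Rightarrow> real) \<Rightarrow> (nat \<Rightarrow> nat \<Rightarrow> real) \<Rightarrow> nat \<Rightarrow> nat \<Rightarrow> real" where
  "t_ext b t j i = (if j = 0 then b i else t j i)"

definition f_coeff ::
    "(nat \<Rightarrow> real) \<Rightarrow> (nat \<Rightarrow> nat \<Rightarrow> real) \<Rightarrow> (nat \<Rightarrow> nat \<Rightarrow> real) \<Rightarrow> nat \<Rightarrow> nat \<Rightarrow> real" where
  "f_coeff b t p i j = t_ext b t j i * S_coeff p i j"

end

theory Submission
  imports Defs
begin

text \<open>
  A Gram decomposition of the resource state turns teleportation into a sum of conjugations
  \<open>X \<mapsto> K X K\<^sup>*\<close>, which gives complete positivity. The Bell projectors are diagonal in the
  Pauli basis, \<open>E\<^sub>k = 1/4 (\<Sum>j. \<plusminus> \<sigma>\<^sub>j \<otimes> \<sigma>\<^sub>j)\<close>, so the outcome \<open>k\<close> contracts the input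
  with the correlation matrix of the resource up to signs, and the correction \<open>\<sigma>\<^sub>l\<close> only changes
  signs again. The local Bloch vector \<open>a\<close> enters only the outcome probabilities and cancels in the
  sum over \<open>k\<close>.
\<close>

section \<open>Positive semidefinite kernels\<close>

text \<open>The index set is a set rather than a type, so that a Gram decomposition can be built by
  induction on it, one index at a time.\<close>

definition psd_kernel :: "'a set \<Rightarrow> ('a \<Rightarrow> 'a \<Rightarrow> complex) \<Rightarrow> bool" where
  "psd_kernel S K \<longleftrightarrow> (\<forall>v. (\<Sum>i\<in>S. \<Sum>j\<in>S. cnj (v i) * K i j * v j) \<in> \<real>\<^sub>\<ge>\<^sub>0)"

lemma psd_kernel_pair:
  assumes "finite S" "psd_kernel S K" "x \<in> S" "y \<in> S" "x \<noteq> y"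
  shows "cnj u * K x x * u + cnj u * K x y * w + cnj w * K y x * u + cnj w * K y y * w \<in> \<real>\<^sub>\<ge>\<^sub>0"
proof -
  define v where "v = (\<lambda>i. if i = x then u else if i = y then w else 0)"
  have "(\<Sum>i\<in>S. \<Sum>j\<in>S. cnj (v i) * K i j * v j) = (\<Sum>i\<in>{x,y}. \<Sum>j\<in>{x,y}. cnj (v i) * K i j * v j)"
    using assms by (intro sum.mono_neutral_cong_right) (auto simp: v_def intro!: sum.mono_neutral_right)
  also have "\<dots> = cnj u * K x x * u + cnj u * K x y * w + cnj w * K y x * u + cnj w * K y y * w"
    using assms(5) by (simp add: v_def)
  finally show ?thesis
    using assms(2)[unfolded psd_kernel_def, THEN spec, of v] by (simp only:)
qed

lemma psd_kernel_diag:
  assumes "finite S" "psd_kernel S K" "x \<in> S"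
  shows "K x x \<in> \<real>\<^sub>\<ge>\<^sub>0"
proof -
  define v where "v = (\<lambda>i. if i = x then 1 else (0 :: complex))"
  have "(\<Sum>i\<in>S. \<Sum>j\<in>S. cnj (v i) * K i j * v j) = (\<Sum>i\<in>{x}. \<Sum>j\<in>{x}. K i j)"
    using assms by (intro sum.mono_neutral_cong_right) (auto simp: v_def intro!: sum.mono_neutral_cong_right)
  then show ?thesis
    using assms(2)[unfolded psd_kernel_def, THEN spec, of v] by simp
qed

text \<open>Polarization on two indices: realness of the form at \<open>(1, 1)\<close> makes the
  imaginary parts of \<open>K x y\<close> and \<open>K y x\<close> opposite, and realness at
  \<open>(1, \<i>)\<close> makes their real parts equal.\<close>

lemma psd_kernel_hermitian:
  assumes "finite S" "psd_kernel S K" "x \<in> S" "y \<in> S"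
  shows "K y x = cnj (K x y)"
proof (cases "x = y")
  case True
  then show ?thesis
    using psd_kernel_diag[OF assms(1-3)] by (simp add: complex_nonneg_Reals_iff complex_eq_iff)
next
  case False
  have "Im (K x x) = 0" "Im (K y y) = 0"
    using psd_kernel_diag[OF assms(1,2)] assms(3,4) by (auto simp: complex_nonneg_Reals_iff)
  then show ?thesis
    using psd_kernel_pair[OF assms False, of 1 1] psd_kernel_pair[OF assms False, of 1 \<i>]
    by (auto simp: complex_nonneg_Reals_iff complex_eq_iff)
qed

text \<open>Without a diagonal term the form depends on the coordinate at \<open>x\<close> only
  through its cross terms, so a nonzero \<open>K x y\<close> would make it unbounded below.\<close>

lemma psd_kernel_zero_diag:
  assumes "finite S" "psd_kernel S K" "x \<in> S" "y \<in> S" "K x x = 0"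
  shows "K x y = 0"
proof (cases "x = y")
  case True
  then show ?thesis
    using assms(5) by simp
next
  case False
  show ?thesis
  proof (rule ccontr)
    assume nz: "K x y \<noteq> 0"
    \<comment> \<open>At the vector with entries \<open>- (c * K x y)\<close> and \<open>1\<close>
      the form equals \<open>Re (K y y) - 2 * c * (cmod (K x y))\<^sup>2\<close>; this
      \<open>c\<close> makes it exactly \<open>-1\<close>.\<close>
    define c where "c = (Re (K y y) + 1) / (2 * (cmod (K x y))\<^sup>2)"
    have herm: "K y x = cnj (K x y)"
      using psd_kernel_hermitian[OF assms(1-4)] .
    have "0 \<le> Re (cnj (- (c * K x y)) * K x y + K y x * (- (c * K x y)) + K y y)"
      using psd_kernel_pair[OF assms(1-4) False, of "- (c * K x y)" 1] assms(5)
      by (simp add: complex_nonneg_Reals_iff)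
    also have "\<dots> = Re (K y y) - 2 * c * (cmod (K x y))\<^sup>2"
      unfolding herm cmod_power2 by (simp add: algebra_simps power2_eq_square)
    also have "\<dots> = - 1"
      using nz by (simp add: c_def field_simps)
    finally show False by simp
  qed
qed

text \<open>
  Gaussian elimination: subtracting the rank-one kernel of column \<open>x\<close> leaves a positive
  semidefinite Schur complement. If \<open>K x x = 0\<close>, the whole column vanishes and the junk value of
  division by zero gives the right answer.
\<close>

lemma psd_kernel_Schur_complement:
  assumes "finite S" "x \<notin> S" "psd_kernel (insert x S) K"
  shows "psd_kernel S (\<lambda>i j. K i j - K i x * K x j / K x x)"
  unfolding psd_kernel_def
proof
  fix v :: "'a \<Rightarrow> complex"
  define q where "q = (\<Sum>j\<in>S. K x j * v j)"
  \<comment> \<open>Completing the square: for a nonzero pivot, this coordinate at \<open>x\<close>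
    minimizes the form over all extensions of \<open>v\<close>, and the minimum is the form of the
    Schur complement at \<open>v\<close>.\<close>
  define u where "u = (\<lambda>i. if i = x then - q / K x x else v i)"
  have herm: "K i x = cnj (K x i)" if "i \<in> S" for i
    using psd_kernel_hermitian[of "insert x S" K x i] assms that by auto
  have diag: "cnj (K x x) = K x x"
    using psd_kernel_hermitian[of "insert x S" K x x] assms by auto
  have zero: "K x x = 0 \<Longrightarrow> q = 0"
    unfolding q_def using psd_kernel_zero_diag[of "insert x S" K x] assms by (intro sum.neutral) auto
  have cq: "(\<Sum>i\<in>S. cnj (v i) * K i x) = cnj q"
    unfolding q_def cnj_sum by (intro sum.cong) (auto simp: herm)
  have u: "u x = - q / K x x" "\<And>i. i \<in> S \<Longrightarrow> u i = v i"
    using assms(2) by (auto simp: u_def)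
  have row: "(\<Sum>j\<in>S. cnj (u x) * K x j * v j) = cnj (u x) * q"
    unfolding q_def sum_distrib_left by (simp add: mult.assoc)
  have col: "(\<Sum>i\<in>S. cnj (v i) * K i x * u x) = cnj q * u x"
    unfolding cq[symmetric] sum_distrib_right ..
  have "(\<Sum>i\<in>insert x S. \<Sum>j\<in>insert x S. cnj (u i) * K i j * u j)
      = cnj (u x) * K x x * u x + cnj (u x) * q + cnj q * u x
        + (\<Sum>i\<in>S. \<Sum>j\<in>S. cnj (v i) * K i j * v j)"
    using assms(1,2) by (simp add: u(2) sum.distrib row col cong: sum.cong)
  also have "cnj (u x) * K x x * u x + cnj (u x) * q + cnj q * u x = - (cnj q * q / K x x)"
    using zero by (cases "K x x = 0") (auto simp: u(1) diag field_simps)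
  also have "cnj q * q / K x x = (\<Sum>i\<in>S. \<Sum>j\<in>S. cnj (v i) * (K i x * K x j / K x x) * v j)"
    unfolding cq[symmetric] unfolding q_def sum_product sum_divide_distrib
    by (intro sum.cong refl) (simp add: mult_ac)
  finally have eq: "(\<Sum>i\<in>insert x S. \<Sum>j\<in>insert x S. cnj (u i) * K i j * u j)
      = (\<Sum>i\<in>S. \<Sum>j\<in>S. cnj (v i) * (K i j - K i x * K x j / K x x) * v j)"
    by (simp add: sum_subtractf algebra_simps)
  show "(\<Sum>i\<in>S. \<Sum>j\<in>S. cnj (v i) * (K i j - K i x * K x j / K x x) * v j) \<in> \<real>\<^sub>\<ge>\<^sub>0"
    unfolding eq[symmetric] by (rule assms(3)[unfolded psd_kernel_def, THEN spec])
qed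

text \<open>Cholesky factorization: each eliminated index contributes one rank-one term, and the
  Schur complement left over is factored by induction. Hence the vectors are indexed by
  \<open>S\<close> itself.\<close>

lemma psd_kernel_Gram:
  assumes "finite S" "psd_kernel S K"
  shows "\<exists>w. \<forall>i\<in>S. \<forall>j\<in>S. K i j = (\<Sum>m\<in>S. w m i * cnj (w m j))"
  using assms
proof (induction S arbitrary: K)
  case empty
  then show ?case by simp
next
  case (insert x S)
  from insert.IH[OF psd_kernel_Schur_complement[OF insert.hyps insert.prems]]
  obtain w where w: "\<forall>i\<in>S. \<forall>j\<in>S. K i j - K i x * K x j / K x x = (\<Sum>m\<in>S. w m i * cnj (w m j))"
    by blast
  define d where "d = Re (K x x)"
  have d: "K x x = of_real d" "0 \<le> d"
    using psd_kernel_diag[of "insert x S" K x] insert by (auto simp: d_def complex_nonneg_Reals_iff complex_eq_iff)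
  \<comment> \<open>The new vector is the pivot column divided by the root of the pivot; the old
    ones are extended by zero at \<open>x\<close>. For \<open>d = 0\<close> division by zero makes
    the new vector zero, as it should be.\<close>
  define w' where "w' = (\<lambda>m i. if m = x then K i x / of_real (sqrt d) else if i = x then 0 else w m i)"
  have herm: "K j i = cnj (K i j)" if "i \<in> insert x S" "j \<in> insert x S" for i j
    by (rule psd_kernel_hermitian[of "insert x S"]) (use insert.hyps insert.prems that in auto)
  have zero: "K x j = 0" if "d = 0" "j \<in> insert x S" for j
    by (rule psd_kernel_zero_diag[of "insert x S"]) (use insert.hyps insert.prems that d in auto)
  have zero': "K i x = 0" if "d = 0" "i \<in> insert x S" for i
    unfolding herm[OF insertI1 that(2)] zero[OF that] by simp
  have sq: "complex_of_real (sqrt d) * complex_of_real (sqrt d) = of_real d"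
    using d(2) by (metis of_real_mult real_sqrt_mult_self abs_of_nonneg)
  have lead: "w' x i * cnj (w' x j) = K i x * K x j / K x x" if "i \<in> insert x S" "j \<in> insert x S" for i j
    using herm[of x j] that d sq by (simp add: w'_def)
  have "K i j = (\<Sum>m\<in>insert x S. w' m i * cnj (w' m j))" if ij: "i \<in> insert x S" "j \<in> insert x S" for i j
  proof -
    have "(\<Sum>m\<in>S. w' m i * cnj (w' m j)) = K i j - K i x * K x j / K x x"
    \<comment> \<open>In the row and column of \<open>x\<close> the pivot term already reproduces
      \<open>K\<close>, so the remaining vectors must contribute nothing there.\<close>
    proof (cases "i = x \<or> j = x")
      case True
      then have "(\<Sum>m\<in>S. w' m i * cnj (w' m j)) = 0"
        using insert.hyps by (intro sum.neutral) (auto simp: w'_def)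
      moreover have "K i j = K i x * K x j / K x x"
        using True zero zero' ij d by (cases "d = 0") auto
      ultimately show ?thesis by simp
    next
      case False
      then have "(\<Sum>m\<in>S. w' m i * cnj (w' m j)) = (\<Sum>m\<in>S. w m i * cnj (w m j))"
        using insert.hyps by (intro sum.cong) (auto simp: w'_def)
      then show ?thesis using w False ij by auto
    qed
    then show ?thesis
      using insert.hyps lead[OF ij] by simp
  qed
  then show ?case by blast
qed

text \<open>For a resource state, each \<open>w m\<close> is an unnormalized pure state of an
  ensemble; it will supply one Kraus operator.\<close>

corollary pos_semidef_Gram:
  fixes A :: "('n::finite) cmat"
  assumes "pos_semidef A"
  shows "\<exists>w. \<forall>i j. A $ i $ j = (\<Sum>m\<in>(UNIV :: 'n set). w m i * cnj (w m j))"
proof -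
  have "psd_kernel UNIV (\<lambda>i j. A $ i $ j)"
    unfolding psd_kernel_def
  proof
    fix v :: "'n \<Rightarrow> complex"
    have "cdot (\<chi> i. v i) (A *v (\<chi> i. v i)) \<in> \<real>\<^sub>\<ge>\<^sub>0"
      using assms unfolding pos_semidef_def by blast
    then show "(\<Sum>i\<in>UNIV. \<Sum>j\<in>UNIV. cnj (v i) * A $ i $ j * v j) \<in> \<real>\<^sub>\<ge>\<^sub>0"
      by (simp add: cdot_def matrix_vector_mult_def sum_distrib_left mult.assoc)
  qed
  from psd_kernel_Gram[OF finite this]
  show ?thesis by (simp only: ball_UNIV)
qed

section \<open>Completely positive maps\<close>

lemma cdot_sum_matrix: "cdot u ((\<Sum>i\<in>I. M i) *v w) = (\<Sum>i\<in>I. cdot u (M i *v w))"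
proof (induction I rule: infinite_finite_induct)
  case (infinite A)
  then show ?case by (simp add: cdot_def)
next
  case empty
  then show ?case by (simp add: cdot_def)
next
  case (insert x F)
  then show ?case
   by (simp add: matrix_vector_mult_add_rdistrib) (simp add: cdot_def sum.distrib distrib_left)
qed
lemma nonneg_Reals_sum:
  "(\<And>i. i \<in> I \<Longrightarrow> f i \<in> \<real>\<^sub>\<ge>\<^sub>0) \<Longrightarrow> sum f I \<in> (\<real>\<^sub>\<ge>\<^sub>0 :: complex set)"
  by (induction I rule: infinite_finite_induct) (auto intro: nonneg_Reals_add_I)

lemma completely_positive_sum:
  fixes F :: "'i \<Rightarrow> ('m::finite) cmat \<Rightarrow> ('n::finite) cmat"
  assumes F: "\<And>i. i \<in> I \<Longrightarrow> completely_positive (F i)"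
  shows "completely_positive (\<lambda>X. \<Sum>i\<in>I. F i X)"
  unfolding completely_positive_def
proof (intro allI impI)
  fix n and X :: "nat \<Rightarrow> nat \<Rightarrow> 'm cmat"
  assume X: "block_pos_semidef n X"
  show "block_pos_semidef n (\<lambda>r s. \<Sum>i\<in>I. F i (X r s))"
    unfolding block_pos_semidef_def
  proof
    fix v :: "nat \<Rightarrow> complex^'n"
    have FX: "(\<Sum>r<n. \<Sum>s<n. cdot (v r) (F i (X r s) *v v s)) \<in> \<real>\<^sub>\<ge>\<^sub>0" if "i \<in> I" for i
    proof -
      have "block_pos_semidef n (\<lambda>r s. F i (X r s))"
        using F[OF that] X by (simp add: completely_positive_def)
      then show ?thesis by (simp add: block_pos_semidef_def)
    qed
    have "(\<Sum>r<n. \<Sum>s<n. cdot (v r) ((\<Sum>i\<in>I. F i (X r s)) *v v s))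
        = (\<Sum>r<n. \<Sum>s<n. \<Sum>i\<in>I. cdot (v r) (F i (X r s) *v v s))"
      by (simp only: cdot_sum_matrix)
    also have "\<dots> = (\<Sum>r<n. \<Sum>i\<in>I. \<Sum>s<n. cdot (v r) (F i (X r s) *v v s))"
      by (rule sum.cong[OF refl sum.swap])
    also have "\<dots> = (\<Sum>i\<in>I. \<Sum>r<n. \<Sum>s<n. cdot (v r) (F i (X r s) *v v s))"
      by (rule sum.swap)
    also have "\<dots> \<in> \<real>\<^sub>\<ge>\<^sub>0"
      by (intro nonneg_Reals_sum FX)
    finally show "(\<Sum>r<n. \<Sum>s<n. cdot (v r) ((\<Sum>i\<in>I. F i (X r s)) *v v s)) \<in> \<real>\<^sub>\<ge>\<^sub>0" .
  qed
qed

lemma completely_positive_scaleR: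
  assumes "completely_positive F" "0 \<le> c"
  shows "completely_positive (\<lambda>X. c *\<^sub>R F X)"
proof -
  have "cdot v ((c *\<^sub>R M) *v w) = of_real c * cdot v (M *v w)" for v w and M :: "'b cmat"
    unfolding cdot_def matrix_vector_mult_def
    by (simp add: sum_distrib_left mult_ac scaleR_conv_of_real[where 'a=complex])
  then show ?thesis
    using assms unfolding completely_positive_def block_pos_semidef_def
    by (simp add: sum_distrib_left[symmetric] nonneg_Reals_mult_I)
qed

definition adjoint_mat :: "complex^'n^'m \<Rightarrow> complex^'m^'n" where
  "adjoint_mat A = (\<chi> i j. cnj (A $ j $ i))"

lemma cdot_adjoint: "cdot v (A *v w) = cdot (adjoint_mat A *v v) w"
  unfolding cdot_def matrix_vector_mult_def adjoint_mat_def
  by (simp add: sum_distrib_left sum_distrib_right mult_ac, subst sum.swap, rule refl)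

text \<open>The outer factors move onto the test vectors: the block form of the image at
  \<open>v\<close> is the block form of \<open>X\<close> at the vectors
  \<open>adjoint_mat A *v v r\<close>.\<close>

lemma completely_positive_conjugation:
  "completely_positive (\<lambda>X. A ** X ** adjoint_mat A)"
  unfolding completely_positive_def block_pos_semidef_def
  by (auto simp: matrix_vector_mul_assoc[symmetric] cdot_adjoint[of _ A])

lemma completely_positive_compose:
  "completely_positive F \<Longrightarrow> completely_positive G \<Longrightarrow> completely_positive (\<lambda>X. F (G X))"
  by (auto simp: completely_positive_def)

section \<open>Noisy teleportation\<close>

lemma UNIV_2_eq: "(UNIV :: 2 set) = {0, 1}"
proof -
  have "i = 0 \<or> i = 1" for i :: 2
    using exhaust_2[of i] by auto
  then show ?thesis by blast
qed

lemma sum_2': "(\<Sum>i\<in>UNIV. f (i::2)) = f 0 + f 1"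
  by (simp add: UNIV_2_eq)

lemma all_2': "(\<forall>i. P (i::2)) \<longleftrightarrow> P 0 \<and> P 1"
  using UNIV_2_eq by (metis UNIV_I empty_iff insertE)

lemma sum_UNIV_prod:
  "(\<Sum>x\<in>UNIV. f x) = (\<Sum>i\<in>(UNIV::'a::finite set). \<Sum>j\<in>(UNIV::'b::finite set). f (i, j))"
  unfolding UNIV_Times_UNIV[symmetric] by (simp add: sum.cartesian_product)

text \<open>The identity on B collapses the sum over its index. Keeping \<open>v\<close> arbitrary
  lets the formula serve both the explicit Bell outcomes and the Kraus representation.\<close>

lemma trace_CA_projector:
  "trace_CA (on_CA (projector v) ** (X \<otimes> T)) $ b $ b' =
    (\<Sum>c\<in>UNIV. \<Sum>a\<in>UNIV. \<Sum>c'\<in>UNIV. \<Sum>a'\<in>UNIV.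
      v $ (c, a) * cnj (v $ (c', a')) * X $ c' $ c * T $ (a', b) $ (a, b'))"
  (is "?L = ?R")
proof -
  have "(\<Sum>d\<in>UNIV. (on_CA (projector v)) $ (c, a, b) $ (c', a', d) * (X \<otimes> T) $ (c', a', d) $ (c, a, b'))
    = v $ (c, a) * cnj (v $ (c', a')) * X $ c' $ c * T $ (a', b) $ (a, b')" for c a c' a'
  proof -
    have "(\<Sum>d\<in>UNIV. (on_CA (projector v)) $ (c, a, b) $ (c', a', d) * (X \<otimes> T) $ (c', a', d) $ (c, a, b'))
      = (\<Sum>d\<in>UNIV. if b = d then v $ (c, a) * cnj (v $ (c', a')) * X $ c' $ c * T $ (a', b) $ (a, b') else 0)"
      by (intro sum.cong refl) (simp add: on_CA_def projector_def kron_def mat_def)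
    then show ?thesis by simp
  qed
  then show ?thesis
    by (simp add: trace_CA_def matrix_matrix_mult_def sum_UNIV_prod)
qed

lemma pauli_simps:
  "pauli 0 = mat2 1 0 0 1" "pauli (Suc 0) = mat2 0 1 1 0" "pauli 2 = mat2 0 (- \<i>) \<i> 0" "pauli 3 = mat2 1 0 0 (- 1)"
  by (simp_all add: pauli_def)

lemma mat2_nth [simp]:
  "mat2 a b c d $ 0 $ 0 = a" "mat2 a b c d $ 0 $ 1 = b" "mat2 a b c d $ 1 $ 0 = c" "mat2 a b c d $ 1 $ 1 = d"
  by (simp_all add: mat2_def)

lemma bell_vector_nth:
  "bell_vector 0 $ (c, a) = (if c = a then 1 / sqrt 2 else 0)"
  "bell_vector (Suc 0) $ (c, a) = (if c = a then 0 else 1 / sqrt 2)"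
  "bell_vector 2 $ (c, a) = (if c = a then 0 else if c = 0 then 1 / sqrt 2 else - (1 / sqrt 2))"
  "bell_vector 3 $ (c, a) = (if c = a then if c = 0 then 1 / sqrt 2 else - (1 / sqrt 2) else 0)"
  using exhaust_2[of c] exhaust_2[of a]
  by (auto simp: bell_vector_def ket2_def axis_def scaleR_conv_of_real[where 'a=complex])

text \<open>Each Bell vector has two nonzero entries, so four terms survive, each with weight 1/2 up
  to sign. \<open>X\<close> and \<open>T\<close> are arbitrary, so both the Bloch computation and
  the trace computation can use this.\<close>

lemma trace_CA_bell:
  "trace_CA (on_CA (bell_projector 0) ** (X \<otimes> T)) $ b $ b' =
     (X $ 0 $ 0 * T $ (0,b) $ (0,b') + X $ 1 $ 0 * T $ (1,b) $ (0,b')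
    + X $ 0 $ 1 * T $ (0,b) $ (1,b') + X $ 1 $ 1 * T $ (1,b) $ (1,b')) / 2"
  (is ?t0)
  "trace_CA (on_CA (bell_projector (Suc 0)) ** (X \<otimes> T)) $ b $ b' =
     (X $ 0 $ 0 * T $ (1,b) $ (1,b') + X $ 1 $ 0 * T $ (0,b) $ (1,b')
    + X $ 0 $ 1 * T $ (1,b) $ (0,b') + X $ 1 $ 1 * T $ (0,b) $ (0,b')) / 2"
  (is ?t1)
  "trace_CA (on_CA (bell_projector 2) ** (X \<otimes> T)) $ b $ b' =
     (X $ 0 $ 0 * T $ (1,b) $ (1,b') - X $ 1 $ 0 * T $ (0,b) $ (1,b')
    - X $ 0 $ 1 * T $ (1,b) $ (0,b') + X $ 1 $ 1 * T $ (0,b) $ (0,b')) / 2"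
  (is ?t2)
  "trace_CA (on_CA (bell_projector 3) ** (X \<otimes> T)) $ b $ b' =
     (X $ 0 $ 0 * T $ (0,b) $ (0,b') - X $ 1 $ 0 * T $ (1,b) $ (0,b')
    - X $ 0 $ 1 * T $ (0,b) $ (1,b') + X $ 1 $ 1 * T $ (1,b) $ (1,b')) / 2"
  (is ?t3)
proof -
  have [simp]: "complex_of_real (sqrt 2) * complex_of_real (sqrt 2) = 2"
    by (metis of_real_mult of_real_numeral real_sqrt_mult_self abs_numeral)
  show ?t0 ?t1 ?t2 ?t3
    unfolding bell_projector_def trace_CA_projector
    by (simp_all add: sum_2' bell_vector_nth add_divide_distrib diff_divide_distrib)
qed

text \<open>
  \<open>E\<^sub>k = 1/4 (\<Sum>j\<le>3. bell_sign k j \<sigma>\<^sub>j \<otimes> \<sigma>\<^sub>j)\<close>, and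
  \<open>\<sigma>\<^sub>l \<sigma>\<^sub>i \<sigma>\<^sub>l = pauli_sign i l \<sigma>\<^sub>i\<close> for \<open>i \<noteq> 0\<close>.
\<close>

definition bell_sign :: "nat \<Rightarrow> nat \<Rightarrow> real" where
  "bell_sign k j = (-1) ^ (kdelta k 0 + kdelta j 2 + kdelta j 0 + kdelta k j + 1)"

definition pauli_sign :: "nat \<Rightarrow> nat \<Rightarrow> real" where
  "pauli_sign i l = (-1) ^ (kdelta i l + kdelta 0 l + 1)"

text \<open>The exponent separates into a measurement part in \<open>k\<close>, \<open>j\<close> and
  a correction part in \<open>i\<close>, \<open>l\<close>. The extra \<open>1\<close> in each sign
  cancels in the product; it normalizes \<open>bell_sign k 0\<close> to 1.\<close>

lemma S_coeff_signs:
  "S_coeff p i j = (1/4) * (\<Sum>k\<le>3. \<Sum>l\<le>3. bell_sign k j * pauli_sign i l * p l k)"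
  unfolding S_coeff_def bell_sign_def pauli_sign_def by (simp add: power_add mult_ac)

section \<open>Pauli coordinates and the action on Bloch vectors\<close>

lemma sum_1_3: "(\<Sum>i=1..3. f i) = f (Suc 0) + f 2 + f (3::nat)"
  by (simp add: numeral_3_eq_3 numeral_2_eq_2 add.assoc)

lemma le_3_cases:
  assumes "k \<le> (3::nat)"
  obtains "k = 0" | "k = Suc 0" | "k = 2" | "k = 3"
  using assms by linarith

text \<open>An unnormalized Bloch operator: \<open>w\<close> is the trace, which is kept free
  because the operators conditioned on a measurement outcome do not have trace 1.\<close>

definition pauli_expansion :: "real \<Rightarrow> real \<Rightarrow> real \<Rightarrow> real \<Rightarrow> 2 cmat" where
  "pauli_expansion w x y z =
    mat2 ((w + z) / 2) ((x - \<i> * y) / 2) ((x + \<i> * y) / 2) ((w - z) / 2)"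

lemma bloch_operator_eq_pauli_expansion: "bloch_operator x y z = pauli_expansion 1 x y z"
  by (simp add: vec_eq_iff all_2' pauli_expansion_def bloch_operator_def pauli_simps mat_def
      scaleR_conv_of_real[where 'a=complex])

lemma pauli_expansion_scaleR:
  "c *\<^sub>R pauli_expansion w x y z = pauli_expansion (c * w) (c * x) (c * y) (c * z)"
  by (simp add: vec_eq_iff all_2' pauli_expansion_def scaleR_conv_of_real[where 'a=complex] algebra_simps)

lemma pauli_expansion_sum:
  "(\<Sum>i\<in>I. pauli_expansion (w i) (x i) (y i) (z i)) = pauli_expansion (sum w I) (sum x I) (sum y I) (sum z I)"
proof -
  have add: "pauli_expansion w x y z + pauli_expansion w' x' y' z'
    = pauli_expansion (w + w') (x + x') (y + y') (z + z')" for w x y z w' x' y' z'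
    by (simp add: vec_eq_iff all_2' pauli_expansion_def field_simps)
  have zero: "pauli_expansion 0 0 0 0 = 0"
    by (simp add: vec_eq_iff all_2' pauli_expansion_def)
  show ?thesis
    by (induction I rule: infinite_finite_induct) (simp_all add: add zero)
qed

text \<open>Pauli matrices are trace-orthogonal, so the \<sigma>_j \<otimes> \<sigma>_j term of the
  projector pairs the input coordinate \<open>j\<close> with the part of the resource having
  \<sigma>_j on A. Paired with \<open>a\<close> it gives a contribution to the trace, paired with
  \<open>t\<close> one to Bob's Bloch coordinates.\<close>

lemma trace_CA_bell_bloch:
  assumes "k \<le> 3"
  and T: "T = (1/4) *\<^sub>R (mat 1 \<otimes> mat 1
           + (\<Sum>i=1..3. a i *\<^sub>R (pauli i \<otimes> mat 1))
           + (\<Sum>j=1..3. b j *\<^sub>R (mat 1 \<otimes> pauli j))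
           + (\<Sum>i=1..3. \<Sum>j=1..3. t i j *\<^sub>R (pauli i \<otimes> pauli j)))"
  defines "r \<equiv> (\<lambda>i x y z. b i + bell_sign k 1 * t 1 i * x + bell_sign k 2 * t 2 i * y + bell_sign k 3 * t 3 i * z)"
  shows "trace_CA (on_CA (bell_projector k) ** (bloch_operator x y z \<otimes> T))
    = (1/4) *\<^sub>R pauli_expansion
        (1 + bell_sign k 1 * (a 1 * x) + bell_sign k 2 * (a 2 * y) + bell_sign k 3 * (a 3 * z))
        (r 1 x y z) (r 2 x y z) (r 3 x y z)"
proof -
  have T_nth: "T $ (u, v) $ (u', v') = (mat 1 $ u $ u' * mat 1 $ v $ v'
      + (a 1 * pauli 1 $ u $ u' + a 2 * pauli 2 $ u $ u' + a 3 * pauli 3 $ u $ u') * mat 1 $ v $ v'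
      + mat 1 $ u $ u' * (b 1 * pauli 1 $ v $ v' + b 2 * pauli 2 $ v $ v' + b 3 * pauli 3 $ v $ v')
      + pauli 1 $ u $ u' * (t 1 1 * pauli 1 $ v $ v' + t 1 2 * pauli 2 $ v $ v' + t 1 3 * pauli 3 $ v $ v')
      + pauli 2 $ u $ u' * (t 2 1 * pauli 1 $ v $ v' + t 2 2 * pauli 2 $ v $ v' + t 2 3 * pauli 3 $ v $ v')
      + pauli 3 $ u $ u' * (t 3 1 * pauli 1 $ v $ v' + t 3 2 * pauli 2 $ v $ v' + t 3 3 * pauli 3 $ v $ v')) / 4"
    for u v u' v'
    unfolding T sum_1_3 by (simp add: kron_def scaleR_conv_of_real[where 'a=complex] algebra_simps)
  show ?thesis
    using assms(1)
    by (cases k rule: le_3_cases)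
      (simp_all add: vec_eq_iff all_2' trace_CA_bell T_nth bloch_operator_eq_pauli_expansion pauli_expansion_def pauli_simps
        mat_def[where 'a=complex] scaleR_conv_of_real[where 'a=complex] r_def bell_sign_def kdelta_def field_simps)
qed

text \<open>For nonzero \<open>l\<close>, \<open>pauli l\<close> commutes with the identity and with
  itself and anticommutes with the other two Pauli matrices, whose coordinates therefore
  flip.\<close>

lemma pauli_conjugation_expansion:
  assumes "l \<le> 3"
  shows "pauli l ** pauli_expansion w x y z ** pauli l
    = pauli_expansion w (pauli_sign 1 l * x) (pauli_sign 2 l * y) (pauli_sign 3 l * z)"
  using assms
  by (cases l rule: le_3_cases)
    (simp_all add: vec_eq_iff all_2' pauli_expansion_def matrix_matrix_mult_def sum_2' pauli_simps
       pauli_sign_def kdelta_def field_simps)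

lemma pauli_squared: "l \<le> 3 \<Longrightarrow> pauli l ** pauli l = mat 1"
  by (cases l rule: le_3_cases)
    (simp_all add: vec_eq_iff all_2' matrix_matrix_mult_def sum_2' pauli_simps mat_def)

text \<open>Two signs are positive and two negative, reflecting that the Bell projectors add up to
  the identity, which has no \<sigma>_j \<otimes> \<sigma>_j component for nonzero
  \<open>j\<close>.\<close>

lemma sum_bell_sign: "j \<le> 3 \<Longrightarrow> j \<noteq> 0 \<Longrightarrow> (\<Sum>k\<le>3. bell_sign k j) = 0"
  by (cases j rule: le_3_cases)
    (simp_all add: numeral_3_eq_3 numeral_2_eq_2 bell_sign_def kdelta_def)

lemma f_coeff_sum:
  assumes "i \<noteq> 0"
  shows "f_coeff b t p i 0 + f_coeff b t p i 1 * x + f_coeff b t p i 2 * y + f_coeff b t p i 3 * z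
    = (\<Sum>k\<le>3. \<Sum>l\<le>3. p l k * (1/4 * (pauli_sign i l *
        (b i + bell_sign k 1 * t 1 i * x + bell_sign k 2 * t 2 i * y + bell_sign k 3 * t 3 i * z))))"
proof -
  \<comment> \<open>This puts the constant term \<open>b i\<close> on the same footing as the terms
    in \<open>x\<close>, \<open>y\<close>, \<open>z\<close>, so all four coefficients merge into one
    average over \<open>k\<close> and \<open>l\<close>.\<close>
  have "bell_sign k 0 = 1" for k
    by (simp add: bell_sign_def kdelta_def)
  then show ?thesis
    unfolding f_coeff_def t_ext_def S_coeff_signs
    by (simp add: sum_distrib_left sum_distrib_right sum.distrib algebra_simps)
qed

lemma noisy_teleportation_bloch:
  assumes "classical_channel p"
  and T: "T = (1/4) *\<^sub>R (mat 1 \<otimes> mat 1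
           + (\<Sum>i=1..3. a i *\<^sub>R (pauli i \<otimes> mat 1))
           + (\<Sum>j=1..3. b j *\<^sub>R (mat 1 \<otimes> pauli j))
           + (\<Sum>i=1..3. \<Sum>j=1..3. t i j *\<^sub>R (pauli i \<otimes> pauli j)))"
  shows "noisy_teleportation T p (bloch_operator x y z) =
      bloch_operator
        (f_coeff b t p 1 0 + f_coeff b t p 1 1 * x + f_coeff b t p 1 2 * y + f_coeff b t p 1 3 * z)
        (f_coeff b t p 2 0 + f_coeff b t p 2 1 * x + f_coeff b t p 2 2 * y + f_coeff b t p 2 3 * z)
        (f_coeff b t p 3 0 + f_coeff b t p 3 1 * x + f_coeff b t p 3 2 * y + f_coeff b t p 3 3 * z)"
proof -
  \<comment> \<open>\<open>q k\<close> is four times the trace of Bob's operator for outcome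
    \<open>k\<close>, and \<open>r k i\<close> is its \<open>i\<close>-th Pauli coordinate on the
    same scale, before correction.\<close>
  define q where "q k = 1 + bell_sign k 1 * (a 1 * x) + bell_sign k 2 * (a 2 * y) + bell_sign k 3 * (a 3 * z)" for k
  define r where "r k i = b i + bell_sign k 1 * t 1 i * x + bell_sign k 2 * t 2 i * y + bell_sign k 3 * t 3 i * z" for k i
  have "noisy_teleportation T p (bloch_operator x y z)
    = (\<Sum>k\<le>3. \<Sum>l\<le>3. p l k *\<^sub>R (pauli l ** ((1/4) *\<^sub>R pauli_expansion (q k) (r k 1) (r k 2) (r k 3)) ** pauli l))"
    unfolding noisy_teleportation_def q_def r_def
    by (intro sum.cong refl) (simp only: atMost_iff trace_CA_bell_bloch[OF _ T])
  also have "\<dots> = (\<Sum>k\<le>3. \<Sum>l\<le>3. pauli_expansion (p l k * (1/4 * q k)) (p l k * (1/4 * (pauli_sign 1 l * r k 1)))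
      (p l k * (1/4 * (pauli_sign 2 l * r k 2))) (p l k * (1/4 * (pauli_sign 3 l * r k 3))))"
    by (intro sum.cong refl)
      (simp only: pauli_expansion_scaleR pauli_conjugation_expansion atMost_iff mult.left_commute[of "1/4"])
  also have "\<dots> = pauli_expansion (\<Sum>k\<le>3. \<Sum>l\<le>3. p l k * (1/4 * q k))
      (\<Sum>k\<le>3. \<Sum>l\<le>3. p l k * (1/4 * (pauli_sign 1 l * r k 1)))
      (\<Sum>k\<le>3. \<Sum>l\<le>3. p l k * (1/4 * (pauli_sign 2 l * r k 2)))
      (\<Sum>k\<le>3. \<Sum>l\<le>3. p l k * (1/4 * (pauli_sign 3 l * r k 3)))"
    by (simp only: pauli_expansion_sum)
  also have "(\<Sum>k\<le>3. \<Sum>l\<le>3. p l k * (1/4 * q k)) = (\<Sum>k\<le>3. 1/4 * q k)"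
    unfolding sum_distrib_right[symmetric]
    using assms(1) by (intro sum.cong refl) (simp add: classical_channel_def)
  \<comment> \<open>The four constants 1/4 add up to 1, while the terms in \<open>a\<close> cancel
    by \<open>sum_bell_sign\<close>.\<close>
  also have "\<dots> = 1"
    unfolding q_def sum_distrib_left[symmetric] sum.distrib sum_distrib_right[symmetric]
    by (simp add: sum_bell_sign)
  finally show ?thesis
    unfolding bloch_operator_eq_pauli_expansion r_def by (simp only: f_coeff_sum[of 1] f_coeff_sum[of 2] f_coeff_sum[of 3])
qed

section \<open>The channel axioms: linearity, trace preservation, complete positivity\<close>

lemma kron_add_left: "(A + B) \<otimes> T = A \<otimes> T + B \<otimes> T"
  by (simp add: kron_def vec_eq_iff algebra_simps)

lemma kron_cscale_left: "cscale c A \<otimes> T = cscale c (A \<otimes> T)"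
  by (simp add: kron_def cscale_def vec_eq_iff algebra_simps)

lemma matrix_mul_cscale: "A ** cscale c B = cscale c (A ** B)" "cscale c A ** B = cscale c (A ** B)"
  by (simp_all add: cscale_def matrix_matrix_mult_def vec_eq_iff sum_distrib_left mult_ac)

lemma trace_CA_add: "trace_CA (A + B) = trace_CA A + trace_CA B"
  by (simp add: trace_CA_def vec_eq_iff sum.distrib)

lemma trace_CA_cscale: "trace_CA (cscale c A) = cscale c (trace_CA A)"
  by (simp add: trace_CA_def cscale_def vec_eq_iff sum_distrib_left)

lemma cscale_sum: "cscale c (\<Sum>i\<in>I. f i) = (\<Sum>i\<in>I. cscale c (f i))"
  by (simp add: cscale_def vec_eq_iff sum_component sum_distrib_left)

lemma cscale_scaleR: "cscale c (r *\<^sub>R A) = r *\<^sub>R cscale c A"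
  by (simp add: cscale_def vec_eq_iff)

lemma noisy_teleportation_add:
  "noisy_teleportation T p (A + B) = noisy_teleportation T p A + noisy_teleportation T p B"
proof -
  have matrix_add_rdistrib: "(M + N) ** P = M ** P + N ** P" for M N P :: "2 cmat"
    by (simp add: matrix_matrix_mult_def vec_eq_iff sum.distrib distrib_right)
  show ?thesis
    by (simp add: noisy_teleportation_def kron_add_left matrix_add_ldistrib matrix_add_rdistrib
        trace_CA_add scaleR_add_right sum.distrib)
qed

lemma noisy_teleportation_cscale:
  "noisy_teleportation T p (cscale c A) = cscale c (noisy_teleportation T p A)"
  by (simp add: noisy_teleportation_def kron_cscale_left matrix_mul_cscale trace_CA_cscale
      cscale_sum cscale_scaleR)

lemma trace_sum: "trace (\<Sum>i\<in>I. f i) = (\<Sum>i\<in>I. trace (f i))"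
  unfolding trace_def sum_component by (rule sum.swap)

lemma trace_scaleR: "trace (c *\<^sub>R A) = c *\<^sub>R trace (A :: 'n::finite cmat)"
  by (simp add: trace_def scaleR_sum_right)

text \<open>The Bell vectors form an orthonormal basis, so summing over outcomes leaves the full
  trace of \<open>A \<otimes> T\<close>.\<close>

lemma trace_bell_outcomes:
  "(\<Sum>k\<le>3. trace (trace_CA (on_CA (bell_projector k) ** (A \<otimes> T)))) = trace A * trace T"
proof -
  have s: "(\<Sum>k\<le>3. f k) = f 0 + f (Suc 0) + f 2 + f (3::nat)" for f :: "nat \<Rightarrow> complex"
    by (simp add: numeral_3_eq_3 numeral_2_eq_2)
  show ?thesis
    by (simp add: s trace_def sum_UNIV_prod sum_2' trace_CA_bell field_simps)
qed

lemma trace_noisy_teleportation: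
  assumes "classical_channel p" "trace T = 1"
  shows "trace (noisy_teleportation T p A) = trace A"
proof -
  let ?M = "\<lambda>k. trace_CA (on_CA (bell_projector k) ** (A \<otimes> T))"
  \<comment> \<open>By cyclicity the two corrections meet and cancel, since \<open>pauli l\<close>
    is an involution.\<close>
  have "trace (pauli l ** ?M k ** pauli l) = trace (?M k)" if "l \<le> 3" for k l
    by (subst trace_mul_sym) (simp add: matrix_mul_assoc pauli_squared[OF that])
  then have "trace (noisy_teleportation T p A) = (\<Sum>k\<le>3. \<Sum>l\<le>3. p l k *\<^sub>R trace (?M k))"
    unfolding noisy_teleportation_def by (simp add: trace_sum trace_scaleR)
  also have "\<dots> = (\<Sum>k\<le>3. trace (?M k))"
    using assms(1) unfolding scaleR_sum_left[symmetric] by (simp add: classical_channel_def)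
  also have "\<dots> = trace A"
    using assms(2) by (simp add: trace_bell_outcomes)
  finally show ?thesis .
qed

lemma completely_positive_trace_CA_projector:
  assumes "pos_semidef T"
  shows "completely_positive (\<lambda>X. trace_CA (on_CA (projector v) ** (X \<otimes> T)))"
proof -
  obtain w where "\<forall>i j. T $ i $ j = (\<Sum>m\<in>(UNIV :: (2 \<times> 2) set). w m i * cnj (w m j))"
    using pos_semidef_Gram[OF assms] ..
  note w = this[rule_format]
  \<comment> \<open>Kraus operators from C to B: the bra of \<open>v\<close> on CA is contracted
    with the ensemble vector \<open>w m\<close> on AB over the shared qubit A.\<close>
  define K :: "2 \<times> 2 \<Rightarrow> 2 cmat"
    where "K m = (\<chi> b c. \<Sum>a\<in>UNIV. cnj (v $ (c, a)) * w m (a, b))" for m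
  have entry: "(K m ** X ** adjoint_mat (K m)) $ b $ b' =
      (\<Sum>c\<in>UNIV. \<Sum>a\<in>UNIV. \<Sum>c'\<in>UNIV. \<Sum>a'\<in>UNIV.
        v $ (c, a) * cnj (v $ (c', a')) * X $ c' $ c * (w m (a', b) * cnj (w m (a, b'))))" for m X b b'
    by (simp add: K_def adjoint_mat_def matrix_matrix_mult_def sum_2' algebra_simps)
  have "trace_CA (on_CA (projector v) ** (X \<otimes> T)) = (\<Sum>m\<in>UNIV. K m ** X ** adjoint_mat (K m))" for X
    unfolding vec_eq_iff trace_CA_projector w sum_component entry sum_distrib_left
    \<comment> \<open>The sum over \<open>m\<close> moves inward past the four qubit sums; fixing
      the index sets makes the swap one-directional.\<close>
    by (simp only: sum.swap[where A = "UNIV :: (2 \<times> 2) set" and B = "UNIV :: 2 set"] simp_thms)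
  then show ?thesis
    by (simp add: completely_positive_sum completely_positive_conjugation)
qed

lemma adjoint_pauli: "l \<le> 3 \<Longrightarrow> adjoint_mat (pauli l) = pauli l"
  by (cases l rule: le_3_cases) (simp_all add: adjoint_mat_def vec_eq_iff all_2' pauli_simps)

text \<open>Pauli matrices are Hermitian, so each correction is again a conjugation composed with
  the measurement map; the probabilities enter as nonnegative weights.\<close>

lemma completely_positive_noisy_teleportation:
  assumes "pos_semidef T" "classical_channel p"
  shows "completely_positive (noisy_teleportation T p)"
proof -
  have "completely_positive (\<lambda>X. pauli l ** trace_CA (on_CA (bell_projector k) ** (X \<otimes> T)) ** pauli l)"
    if "l \<le> 3" for k l
    using completely_positive_compose[OF completely_positive_conjugation[of "pauli l"]
        completely_positive_trace_CA_projector[OF assms(1), of "bell_vector k"]]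
    by (simp add: adjoint_pauli[OF that] bell_projector_def)
  then have "completely_positive (\<lambda>X. \<Sum>k\<le>3. \<Sum>l\<le>3. p l k *\<^sub>R
      (pauli l ** trace_CA (on_CA (bell_projector k) ** (X \<otimes> T)) ** pauli l))"
    using assms(2) by (intro completely_positive_sum completely_positive_scaleR)
      (auto simp: classical_channel_def)
  then show ?thesis
    by (simp add: noisy_teleportation_def[abs_def])
qed

theorem theorem11:
  fixes \<tau> :: "(2 \<times> 2) cmat"
    and a b :: "nat \<Rightarrow> real"
    and t p :: "nat \<Rightarrow> nat \<Rightarrow> real"
  assumes "density_operator \<tau>"
    and "\<tau> = (1/4) *\<^sub>R (mat 1 \<otimes> mat 1
           + (\<Sum>i=1..3. a i *\<^sub>R (pauli i \<otimes> mat 1))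
           + (\<Sum>j=1..3. b j *\<^sub>R (mat 1 \<otimes> pauli j))
           + (\<Sum>i=1..3. \<Sum>j=1..3. t i j *\<^sub>R (pauli i \<otimes> pauli j)))"
    and "classical_channel p"
  shows "let f = f_coeff b t p in quantum_channel (noisy_teleportation \<tau> p) \<and>
    (\<forall>x y z. density_operator (bloch_operator x y z) \<longrightarrow>
      noisy_teleportation \<tau> p (bloch_operator x y z) =
      bloch_operator
        (f 1 0 + f 1 1 * x + f 1 2 * y + f 1 3 * z)
        (f 2 0 + f 2 1 * x + f 2 2 * y + f 2 3 * z)
        (f 3 0 + f 3 1 * x + f 3 2 * y + f 3 3 * z))"
proof -
  have "pos_semidef \<tau>" and "trace \<tau> = 1"
    using assms(1) by (simp_all add: density_operator_def)
  then have "quantum_channel (noisy_teleportation \<tau> p)"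
    unfolding quantum_channel_def
    by (simp add: noisy_teleportation_add noisy_teleportation_cscale
        completely_positive_noisy_teleportation trace_noisy_teleportation assms(3))
  then show ?thesis
    unfolding Let_def using noisy_teleportation_bloch[OF assms(3,2)] by blast
qed

end
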